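(* For any integers $r\ge 1$ and $k\ge 2$, we have $\gamma^+(H_r^k)=\frac{r-1}{r}$, and $H_r^k$ is not $r$-colourable.
   Context: For an integer $k\ge 2$, a $k$-graph ($k$-uniform hypergraph) $H$ consists of a (finite) vertex set $V(H)$ and an edge set $E(H)\subseteq\binom{V(H)}{k}$. A $k$-graph is $F$-free if it contains no copy of $F$ as a (not necessarily induced) subgraph. For a $k$-graph $H$ with $E(H)\neq\emptyset$, the minimum positive codegree $\delta^+_{k-1}(H)$ is the minimum, over all $(k-1)$-subsets $S$ of $V(H)$ that are contained in at least one edge of $H$, of the number of edges of $H$ containing $S$; if $E(H)=\emptyset$ then $\delta^+_{k-1}(H):=0$. For a $k$-graph $F$, $\mathrm{ex}^+_{k-1}(n,F)$ is the maximum of $\delta^+_{k-1}(H)$ over all $n$-vertex $F$-free $k$-graphs $H$, and $\gamma^+(F):=\lim_{n\to\infty}\mathrm{ex}^+_{k-1}(n,F)/n$ (the limit is known to exist). For an integer $r\ge 1$, a $k$-graph is $r$-colourable if its vertices can be coloured with $r$ colours so that no edge is monochromatic. Construction $F(R,H)$: let $k\ge 3$, let $R$ be a $(k-1)$-graph and $H$ a $k$-graph. Let $X$ be a copy of $R$ (the core), and let $S_1,\dots,S_m$ be all the $(k-1)$-edges of $X$. Let $H_1,\dots,H_m$ be copies of $H$ such that $X,H_1,\dots,H_m$ are pairwise vertex-disjoint. Then $F(R,H)$ is the $k$-graph with vertex set $V(X)\cup\bigcup_{j=1}^m V(H_j)$ and edge set $\bigcup_{j=1}^m\{S_j\cup\{x\}: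 x\in V(H_j)\}\cup\bigcup_{j=1}^m E(H_j)$. The $k$-graphs $H_r^k$ are defined inductively for $r\ge1$, $k\ge2$: $H_1^k$ consists of a single $k$-edge (on $k$ vertices); $H_r^2:=K_{r+1}$ (the complete graph on $r+1$ vertices) for $r\ge 1$; and for $r\ge 2$ and $k\ge 3$, $H_r^k:=F(H_r^{k-1},H_{r-1}^k)$. *)

theory Defs
  imports Complex_Main "HOL-Library.Nat_Bijection"
begin

type_synonym 'a hgraph = "'a set \<times> 'a set set"

abbreviation verts :: "'a hgraph \<Rightarrow> 'a set" where "verts \<equiv> fst"
abbreviation edges :: "'a hgraph \<Rightarrow> 'a set set" where "edges \<equiv> snd"

definition kgraph :: "nat \<Rightarrow> 'a hgraph \<Rightarrow> bool" where
  "kgraph k H \<longleftrightarrow> finite (verts H) \<and> (\<forall>e\<in>edges H. e \<subseteq> verts H \<and> card e = k)"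

definition contains_copy :: "'a hgraph \<Rightarrow> 'b hgraph \<Rightarrow> bool" where
  "contains_copy H F \<longleftrightarrow> (\<exists>f. inj_on f (verts F) \<and> f ` verts F \<subseteq> verts H \<and>
     (\<forall>e\<in>edges F. f ` e \<in> edges H))"

definition codegree :: "'a hgraph \<Rightarrow> 'a set \<Rightarrow> nat" where
  "codegree H S = card {e \<in> edges H. S \<subseteq> e}"

(* For a k-graph H; the parameter is the uniformity k, the sets S have size k - 1. *)
definition min_pos_codegree :: "nat \<Rightarrow> 'a hgraph \<Rightarrow> nat" where
  "min_pos_codegree k H = (if edges H = {} then 0 else
     Min (codegree H ` {S. S \<subseteq> verts H \<and> card S = k - 1 \<and> (\<exists>e\<in>edges H. S \<subseteq> e)}))"

(* Every finite hypergraph is isomorphic to one with vertices in nat, so it is enough to let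
   H range over these. Max is junk if no n-vertex k-graph is F-free, which cannot happen
   when F has an edge: see ex_plus_wf. *)
definition ex_plus :: "nat \<Rightarrow> nat \<Rightarrow> 'a hgraph \<Rightarrow> nat" where
  "ex_plus k n F = Max {min_pos_codegree k H | H :: nat hgraph.
     kgraph k H \<and> card (verts H) = n \<and> \<not> contains_copy H F}"

definition gamma_plus :: "nat \<Rightarrow> 'a hgraph \<Rightarrow> real" where
  "gamma_plus k F = lim (\<lambda>n. real (ex_plus k n F) / real n)"

definition colourable :: "nat \<Rightarrow> 'a hgraph \<Rightarrow> bool" where
  "colourable r H \<longleftrightarrow> (\<exists>c :: 'a \<Rightarrow> nat. c ` verts H \<subseteq> {..<r} \<and>
     (\<forall>e\<in>edges H. \<not> (\<exists>i. \<forall>v\<in>e. c v = i)))"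

(* The disjoint copies making up F(R,H) are realised inside nat: a vertex x of R becomes
   core_vertex x, and a vertex x of H in the copy attached to the edge S of R becomes
   copy_vertex S x. Since sum_encode and prod_encode are bijections and set_encode is injective
   on finite sets, all these vertices are distinct as long as the edges of R are finite. *)
definition core_vertex :: "nat \<Rightarrow> nat" where
  "core_vertex x = sum_encode (Inl x)"

definition copy_vertex :: "nat set \<Rightarrow> nat \<Rightarrow> nat" where
  "copy_vertex S x = sum_encode (Inr (prod_encode (set_encode S, x)))"

definition F_constr :: "nat hgraph \<Rightarrow> nat hgraph \<Rightarrow> nat hgraph" where
  "F_constr R H =
     (core_vertex ` verts R \<union> (\<Union>S\<in>edges R. copy_vertex S ` verts H),
      (\<Union>S\<in>edges R. {insert (copy_vertex S x) (core_vertex ` S) | x. x \<in> verts H}) \<union>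
      (\<Union>S\<in>edges R. (\<lambda>e. copy_vertex S ` e) ` edges H))"

definition single_edge :: "nat \<Rightarrow> nat hgraph" where
  "single_edge k = ({..<k}, {{..<k}})"

definition complete_graph :: "nat \<Rightarrow> nat hgraph" where
  "complete_graph n = ({..<n}, {e. e \<subseteq> {..<n} \<and> card e = 2})"

(* Only meaningful for r \<ge> 1 and k \<ge> 2. For r = 1 and k = 2 both base cases
   give the same graph. *)
fun H_graph :: "nat \<Rightarrow> nat \<Rightarrow> nat hgraph" where
  "H_graph r k =
     (if r \<le> 1 then single_edge k
      else if k \<le> 2 then complete_graph (r + 1)
      else F_constr (H_graph r (k - 1)) (H_graph (r - 1) k))"

declare H_graph.simps [simp del]

lemma core_vertex_inject [simp]: "core_vertex x = core_vertex y \<longleftrightarrow> x = y"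
  by (simp add: core_vertex_def sum_encode_eq)

lemma core_vertex_neq_copy_vertex [simp]:
  "core_vertex x \<noteq> copy_vertex S y" "copy_vertex S y \<noteq> core_vertex x"
  by (simp_all add: core_vertex_def copy_vertex_def sum_encode_eq)

lemma copy_vertex_inject:
  "finite S \<Longrightarrow> finite T \<Longrightarrow> copy_vertex S x = copy_vertex T y \<longleftrightarrow> S = T \<and> x = y"
  by (simp add: copy_vertex_def sum_encode_eq prod_encode_eq set_encode_eq)

lemma copy_vertex_inj: "inj (copy_vertex S)"
  by (simp add: inj_on_def copy_vertex_def sum_encode_eq prod_encode_eq)

lemma kgraph_finite_edges: "kgraph k H \<Longrightarrow> finite (edges H)"
  by (rule finite_subset[of _ "Pow (verts H)"]) (auto simp: kgraph_def)

lemma kgraph_F_constr: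
  assumes R: "kgraph (k - 1) R" and H: "kgraph k H" and k: "k \<ge> 1"
  shows "kgraph k (F_constr R H)"
proof -
  have fR: "finite (verts R)" "finite (edges R)" and fH: "finite (verts H)"
    using R H kgraph_finite_edges[OF R] by (auto simp: kgraph_def)
  have "card (insert (copy_vertex S x) (core_vertex ` S)) = k" if "S \<in> edges R" for S x
  proof -
    have S: "finite S" "card S = k - 1"
      using that R finite_subset[OF _ fR(1)] by (auto simp: kgraph_def)
    have "card (core_vertex ` S) = k - 1"
      using S by (simp add: card_image inj_on_def)
    moreover have "copy_vertex S x \<notin> core_vertex ` S" by auto
    ultimately show ?thesis using S k by simp
  qed
  moreover have "card (copy_vertex S ` e) = k" if "e \<in> edges H" for S e
    using that H by (simp add: kgraph_def card_image inj_on_subset[OF copy_vertex_inj])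
  ultimately show ?thesis
    using R H fR fH unfolding kgraph_def F_constr_def by (fastforce simp: image_iff)
qed

lemma kgraph_H_graph: "r \<ge> 1 \<Longrightarrow> k \<ge> 2 \<Longrightarrow> kgraph k (H_graph r k)"
proof (induction r k rule: H_graph.induct)
  case (1 r k)
  show ?case
  proof (cases "r \<le> 1 \<or> k \<le> 2")
    case True
    then show ?thesis using 1(3,4)
      by (subst H_graph.simps) (auto simp: kgraph_def single_edge_def complete_graph_def)
  next
    case False
    then show ?thesis using 1 by (subst H_graph.simps) (auto intro!: kgraph_F_constr)
  qed
qed

lemma min_pos_codegree_le:
  assumes H: "kgraph k H" and k: "k \<ge> 1"
  shows "min_pos_codegree k H \<le> card (edges H)"
proof (cases "edges H = {}")
  case False
  let ?A = "{S. S \<subseteq> verts H \<and> card S = k - 1 \<and> (\<exists>e\<in>edges H. S \<subseteq> e)}"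
  obtain e where e: "e \<in> edges H" using False by auto
  have "k - 1 \<le> card e" using e H by (simp add: kgraph_def)
  then obtain S where "S \<subseteq> e" "card S = k - 1" by (metis obtain_subset_with_card_n)
  then have S: "S \<in> ?A" using e H by (auto simp: kgraph_def)
  have "finite ?A" by (rule finite_subset[of _ "Pow (verts H)"]) (use H in \<open>auto simp: kgraph_def\<close>)
  then have "Min (codegree H ` ?A) \<le> codegree H S" using S by (intro Min_le) auto
  also have "\<dots> \<le> card (edges H)"
    unfolding codegree_def by (rule card_mono) (use kgraph_finite_edges[OF H] in auto)
  finally show ?thesis using False by (simp add: min_pos_codegree_def)
qed (simp add: min_pos_codegree_def)

lemma ex_plus_wf:
  fixes F :: "'a hgraph" and k n :: nat
  assumes k: "k \<ge> 1" and F: "edges F \<noteq> {}"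
  defines "A \<equiv> {min_pos_codegree k H | H :: nat hgraph.
     kgraph k H \<and> card (verts H) = n \<and> \<not> contains_copy H F}"
  shows "finite A" "A \<noteq> {}"
proof -
  have "x \<le> 2 ^ n" if x: "x \<in> A" for x
  proof -
    obtain H :: "nat hgraph" where H: "x = min_pos_codegree k H" "kgraph k H" "card (verts H) = n"
      using x unfolding A_def by blast
    have "card (edges H) \<le> card (Pow (verts H))"
      using H(2) by (intro card_mono) (auto simp: kgraph_def)
    then show ?thesis using min_pos_codegree_le[OF H(2) k] H by (simp add: card_Pow kgraph_def)
  qed
  then show "finite A" by (meson finite_nat_set_iff_bounded_le)
  have "kgraph k ({..<n}, {}) \<and> card (verts ({..<n}, {})) = n \<and> \<not> contains_copy ({..<n}, {}) F"
    using F by (auto simp: kgraph_def contains_copy_def)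
  then show "A \<noteq> {}" unfolding A_def by blast
qed

end

theory Submission
  imports Defs
begin

text \<open>The complete non-monochromatic hypergraph of a balanced \<open>r\<close>-colouring has minimum
  positive codegree about \<open>(1 - 1/r) n\<close> and contains no hypergraph that fails to be
  \<open>r\<close>-colourable. A monochromatic core edge of \<open>F(R,H)\<close> forbids its colour on the attached
  copy of \<open>H\<close>, so \<open>H_graph r k\<close> is indeed not \<open>r\<close>-colourable.

  For the upper bound let \<open>G\<close> have minimum positive codegree at least \<open>(1 - 1/r + \<epsilon>) n\<close>.
  The link of a vertex inherits the codegree condition, so it contains the core. Each core edge
  then has a neighbourhood \<open>N\<close> of size at least \<open>(1 - 1/r + \<epsilon>) n\<close>, and \<open>G\<close> restricted to \<open>N\<close>
  (minus boundedly many used vertices) has relative codegree exceeding \<open>1 - 1/(r - 1)\<close>. As any two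
  neighbourhoods meet when \<open>r \<ge> 2\<close>, an edge of \<open>G\<close> can be moved vertex by vertex into \<open>N\<close>,
  so this restriction has an edge and contains the next copy.\<close>

section \<open>Neighbourhoods and codegrees\<close>

text \<open>Nonemptiness encodes positive codegree: in a k-graph it forces \<open>S\<close> to be a
  (k-1)-subset of an edge. The clause \<open>x \<notin> S\<close> keeps a set \<open>S\<close> that
  is itself an edge from having neighbours in itself.\<close>

definition nbr :: "'a hgraph \<Rightarrow> 'a set \<Rightarrow> 'a set" where
  "nbr G S = {x. x \<notin> S \<and> insert x S \<in> edges G}"

lemma nbr_subset: "kgraph k G \<Longrightarrow> nbr G S \<subseteq> verts G"
  by (auto simp: nbr_def kgraph_def)

lemma finite_nbr: "kgraph k G \<Longrightarrow> finite (nbr G S)"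
  by (rule finite_subset[OF nbr_subset]) (auto simp: kgraph_def)

lemma kgraph_finite_edge: "kgraph k G \<Longrightarrow> e \<in> edges G \<Longrightarrow> finite e"
  by (meson kgraph_def finite_subset)

lemma codegree_eq_card_nbr:
  assumes G: "kgraph k G" and k: "k \<ge> 1" and S: "finite S" "card S = k - 1"
  shows "codegree G S = card (nbr G S)"
proof -
  have "{e \<in> edges G. S \<subseteq> e} = (\<lambda>x. insert x S) ` nbr G S"
  proof (intro equalityI subsetI)
    fix e assume e: "e \<in> {e \<in> edges G. S \<subseteq> e}"
    then have "finite e" "card e = k"
      using G kgraph_finite_edge[OF G] by (auto simp: kgraph_def)
    then have "card (e - S) = 1" using e S k by (simp add: card_Diff_subset)
    then obtain x where "e - S = {x}" by (auto simp: card_1_singleton_iff)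
    then have "x \<notin> S" "e = insert x S" using e by auto
    then show "e \<in> (\<lambda>x. insert x S) ` nbr G S" using e by (auto simp: nbr_def)
  qed (auto simp: nbr_def)
  moreover have "inj_on (\<lambda>x. insert x S) (nbr G S)"
    by (auto simp: inj_on_def nbr_def)
  ultimately show ?thesis by (simp add: codegree_def card_image)
qed

text \<open>The sets over which \<open>Min\<close> ranges are exactly those with nonempty
  neighbourhood, and an edge makes this family nonempty. Later codegree arguments can thus speak of
  \<open>nbr\<close> alone.\<close>

lemma min_pos_codegree_ge_iff:
  assumes G: "kgraph k G" and k: "k \<ge> 1" and ne: "edges G \<noteq> {}"
  shows "d \<le> min_pos_codegree k G \<longleftrightarrow> (\<forall>S. nbr G S \<noteq> {} \<longrightarrow> d \<le> card (nbr G S))"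
proof -
  let ?A = "{S. S \<subseteq> verts G \<and> card S = k - 1 \<and> (\<exists>e\<in>edges G. S \<subseteq> e)}"
  have fin: "finite S" if "S \<in> ?A" for S
    using that G by (auto simp: kgraph_def intro: finite_subset)
  have cod: "codegree G S = card (nbr G S)" if "S \<in> ?A" for S
    using that by (intro codegree_eq_card_nbr[OF G k fin]) auto
  have "S \<in> ?A \<longleftrightarrow> nbr G S \<noteq> {}" for S
  proof
    assume S: "S \<in> ?A"
    then obtain e where e: "e \<in> edges G" "S \<subseteq> e" by auto
    then have "card {e \<in> edges G. S \<subseteq> e} \<noteq> 0"
      using kgraph_finite_edges[OF G] by auto
    then show "nbr G S \<noteq> {}" using cod[OF S] by (auto simp: codegree_def)
  next
    assume "nbr G S \<noteq> {}"
    then obtain x where x: "x \<notin> S" "insert x S \<in> edges G" by (auto simp: nbr_def)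
    then have "finite S" using kgraph_finite_edge[OF G] by force
    moreover have "insert x S \<subseteq> verts G" "card (insert x S) = k"
      using x(2) G by (auto simp: kgraph_def)
    ultimately have "S \<subseteq> verts G \<and> card S = k - 1" using x(1) by auto
    then show "S \<in> ?A" using x(2) by blast
  qed
  then have A: "?A = {S. nbr G S \<noteq> {}}" by blast
  have "finite ?A" by (rule finite_subset[of _ "Pow (verts G)"]) (use G in \<open>auto simp: kgraph_def\<close>)
  moreover have "?A \<noteq> {}"
  proof -
    obtain e where e: "e \<in> edges G" using ne by auto
    then have "e \<noteq> {}" using G k by (auto simp: kgraph_def)
    then obtain x where "x \<in> e" by auto
    then have "x \<in> nbr G (e - {x})" using e by (auto simp: nbr_def insert_absorb)
    then show ?thesis unfolding A by blast
  qed
  ultimately have "d \<le> min_pos_codegree k G \<longleftrightarrow> (\<forall>S\<in>?A. d \<le> codegree G S)"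
    using ne by (simp add: min_pos_codegree_def)
  also have "\<dots> \<longleftrightarrow> (\<forall>S\<in>?A. d \<le> card (nbr G S))" using cod by simp
  finally show ?thesis unfolding A by simp
qed

section \<open>Codegree bounds in links and induced subgraphs\<close>

text \<open>Demanding an edge matters: the second clause holds vacuously in an edgeless graph. The
  bound is real so that it can be a multiple of the number of vertices.\<close>

definition codegree_ge :: "real \<Rightarrow> 'a hgraph \<Rightarrow> bool" where
  "codegree_ge d G \<longleftrightarrow> edges G \<noteq> {} \<and> (\<forall>S. nbr G S \<noteq> {} \<longrightarrow> d \<le> real (card (nbr G S)))"

text \<open>The vertex \<open>v\<close> is kept as an isolated vertex, so that codegree bounds relative to the number
  of vertices carry over unchanged.\<close>

definition link :: "'a hgraph \<Rightarrow> 'a \<Rightarrow> 'a hgraph" where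
  "link G v = (verts G, {T. v \<notin> T \<and> insert v T \<in> edges G})"

lemma kgraph_link:
  assumes G: "kgraph k G"
  shows "kgraph (k - 1) (link G v)"
proof -
  have "T \<subseteq> verts G \<and> card T = k - 1" if "v \<notin> T" "insert v T \<in> edges G" for T
  proof -
    have "finite (insert v T)" by (rule kgraph_finite_edge[OF G that(2)])
    moreover have "insert v T \<subseteq> verts G" "card (insert v T) = k"
      using that(2) G by (auto simp: kgraph_def)
    ultimately show ?thesis using that(1) by auto
  qed
  then show ?thesis using G by (simp add: kgraph_def link_def)
qed

lemma nbr_link: "nbr (link G v) T = (if v \<in> T then {} else nbr G (insert v T))"
  by (auto simp: nbr_def link_def insert_commute)

definition induced :: "'a hgraph \<Rightarrow> 'a set \<Rightarrow> 'a hgraph" where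
  "induced G W = (W, {e \<in> edges G. e \<subseteq> W})"

lemma kgraph_induced: "kgraph k G \<Longrightarrow> W \<subseteq> verts G \<Longrightarrow> kgraph k (induced G W)"
  by (auto simp: kgraph_def induced_def intro: finite_subset)

lemma nbr_induced: "nbr (induced G W) T = (if T \<subseteq> W then nbr G T \<inter> W else {})"
  by (auto simp: nbr_def induced_def)

lemma card_Int_ge:
  assumes "finite V" "A \<subseteq> V" "B \<subseteq> V"
  shows "card A + card B \<le> card (A \<inter> B) + card V"
proof -
  have "card A + card B = card (A \<union> B) + card (A \<inter> B)"
    using assms by (intro card_Un_Int) (auto intro: finite_subset)
  moreover have "card (A \<union> B) \<le> card V" using assms by (intro card_mono) auto
  ultimately show ?thesis by simp
qed

text \<open>Extremal choice: an edge with fewest vertices outside \<open>W\<close> has none there,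
  since such a vertex \<open>x\<close> could be exchanged for a member of \<open>W\<close> in the
  neighbourhood of \<open>e - {x}\<close>, which meets \<open>W\<close> by counting.\<close>

lemma ex_edge_subset:
  assumes G: "kgraph k G" and W: "W \<subseteq> verts G" and ne: "edges G \<noteq> {}"
    and meet: "\<And>S. nbr G S \<noteq> {} \<Longrightarrow> card (verts G) < card (nbr G S) + card W"
  shows "\<exists>e\<in>edges G. e \<subseteq> W"
proof -
  obtain e0 where "e0 \<in> edges G" using ne by auto
  then obtain e where e: "e \<in> edges G" and
    least: "\<And>e'. e' \<in> edges G \<Longrightarrow> card (e - W) \<le> card (e' - W)"
    using ex_has_least_nat[of "\<lambda>e. e \<in> edges G" e0 "\<lambda>e. card (e - W)"] by auto
  have fe: "finite e" using kgraph_finite_edge[OF G e] .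
  have "e \<subseteq> W"
  proof
    fix x assume x: "x \<in> e"
    show "x \<in> W"
    proof (rule ccontr)
      assume xW: "x \<notin> W"
      let ?S = "e - {x}"
      have "x \<in> nbr G ?S" using e x by (auto simp: nbr_def insert_absorb)
      then have "card (verts G) < card (nbr G ?S) + card W" by (intro meet) auto
      moreover have "card (nbr G ?S) + card W \<le> card (nbr G ?S \<inter> W) + card (verts G)"
        using G by (intro card_Int_ge nbr_subset[OF G] W) (auto simp: kgraph_def)
      ultimately have "nbr G ?S \<inter> W \<noteq> {}" by auto
      then obtain y where y: "y \<in> W" "insert y ?S \<in> edges G" by (auto simp: nbr_def)
      have "insert y ?S - W \<subset> e - W" using y x xW by auto
      then have "card (insert y ?S - W) < card (e - W)" using fe by (intro psubset_card_mono) auto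
      with least[OF y(2)] show False by simp
    qed
  qed
  with e show ?thesis by blast
qed

section \<open>Forcing copies by the minimum positive codegree\<close>

text \<open>Expresses \<alpha> as an upper bound for the positive codegree density, but for
  individual host graphs, which suits induction. Hosts live on \<open>nat\<close> as in
  \<open>ex_plus\<close>.\<close>

definition forces :: "nat \<Rightarrow> real \<Rightarrow> 'a hgraph \<Rightarrow> bool" where
  "forces k \<alpha> F \<longleftrightarrow> (\<forall>\<epsilon>>0. \<exists>n0. \<forall>G :: nat hgraph.
     kgraph k G \<longrightarrow> n0 \<le> card (verts G) \<longrightarrow>
     codegree_ge ((\<alpha> + \<epsilon>) * real (card (verts G))) G \<longrightarrow> contains_copy G F)"

lemma forcesE:
  assumes "forces k \<alpha> F" "\<epsilon> > 0"
  obtains n0 where "\<And>G :: nat hgraph. kgraph k G \<Longrightarrow> n0 \<le> card (verts G) \<Longrightarrow>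
    codegree_ge ((\<alpha> + \<epsilon>) * real (card (verts G))) G \<Longrightarrow> contains_copy G F"
  using assms unfolding forces_def by meson

definition threshold :: "nat \<Rightarrow> real" where
  "threshold r = (real r - 1) / real r"

lemma forces_single_edge:
  assumes "k \<ge> 1"
  shows "forces k (threshold 1) (single_edge k)"
proof -
  have "contains_copy G (single_edge k)" if G: "kgraph k G" "codegree_ge d G"
    for G :: "nat hgraph" and d
  proof -
    obtain e where e: "e \<in> edges G" using G(2) by (auto simp: codegree_ge_def)
    then have "finite e" "card e = k" "e \<subseteq> verts G"
      using G(1) kgraph_finite_edge[OF G(1)] by (auto simp: kgraph_def)
    then obtain f where "bij_betw f {..<k} e"
      by (metis card_lessThan finite_lessThan finite_same_card_bij)
    then show ?thesis using e \<open>e \<subseteq> verts G\<close>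
      unfolding contains_copy_def single_edge_def
      by (intro exI[of _ f]) (auto simp: bij_betw_def)
  qed
  then show ?thesis unfolding forces_def by blast
qed

text \<open>Passing to a set \<open>W\<close> of at least r/(r+1) of the n vertices costs every
  neighbourhood at most n - |W|. What remains is at least |W| - n/(r+1) + \<epsilon> n, hence at
  least (1 - 1/r + \<epsilon>)|W|, so the same \<epsilon> survives. The bounded set \<open>U\<close>
  leaves room to avoid vertices already in use.\<close>

lemma forces_in_nbr:
  fixes F :: "'a hgraph"
  assumes F: "forces k (threshold r) F" and r: "r \<ge> 1" and \<epsilon>: "\<epsilon> > 0"
  obtains n0 where "\<And>(G :: nat hgraph) S U. kgraph k G \<Longrightarrow> n0 \<le> card (verts G) \<Longrightarrow>
    codegree_ge ((threshold (Suc r) + \<epsilon>) * real (card (verts G))) G \<Longrightarrow>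
    nbr G S \<noteq> {} \<Longrightarrow> finite U \<Longrightarrow> card U \<le> M \<Longrightarrow> contains_copy (induced G (nbr G S - U)) F"
proof -
  obtain n1 where n1: "\<And>G :: nat hgraph. kgraph k G \<Longrightarrow> n1 \<le> card (verts G) \<Longrightarrow>
      codegree_ge ((threshold r + \<epsilon>) * real (card (verts G))) G \<Longrightarrow> contains_copy G F"
    by (rule forcesE[OF F \<epsilon>]) (erule that)
  \<comment> \<open>The term \<open>2 * n1\<close> ensures \<open>n1 \<le> card W\<close>, as
    \<open>W\<close> has at least half the vertices; the ceiling lets \<epsilon> n absorb the at
    most \<open>M\<close> deleted vertices; \<open>Suc\<close> keeps the host nonempty.\<close>
  define n0 where "n0 = Suc (2 * n1 + nat \<lceil>real M / \<epsilon>\<rceil>)"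
  have "contains_copy (induced G (nbr G S - U)) F"
    if G: "kgraph k G" and n: "n0 \<le> card (verts G)"
      and deg: "codegree_ge ((threshold (Suc r) + \<epsilon>) * real (card (verts G))) G"
      and S: "nbr G S \<noteq> {}" and U: "finite U" "card U \<le> M" for G :: "nat hgraph" and S U
  proof -
    let ?n = "real (card (verts G))"
    define W where "W = nbr G S - U"
    have npos: "?n > 0" using n by (simp add: n0_def)
    have "real M / \<epsilon> \<le> ?n" using n unfolding n0_def by linarith
    then have M: "real M \<le> \<epsilon> * ?n" using \<epsilon> by (simp add: field_simps)
    have WV: "W \<subseteq> verts G" using nbr_subset[OF G] by (auto simp: W_def)
    have fV: "finite (verts G)" using G by (simp add: kgraph_def)
    have "card W \<le> card (verts G)" by (rule card_mono[OF fV WV])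
    have th: "threshold (Suc r) = real r / (real r + 1)" by (simp add: threshold_def add.commute)
    have "card (nbr G S) - card U \<le> card W"
      unfolding W_def by (rule diff_card_le_card_Diff[OF U(1)])
    moreover have "(threshold (Suc r) + \<epsilon>) * ?n \<le> real (card (nbr G S))"
      using deg S by (auto simp: codegree_ge_def)
    ultimately have "(threshold (Suc r) + \<epsilon>) * ?n - real M \<le> real (card W)"
      using U(2) by linarith
    then have W: "threshold (Suc r) * ?n \<le> real (card W)" using M by (simp add: algebra_simps)
    \<comment> \<open>Here r \<ge> 1 enters: \<open>W\<close> has at least half the vertices and
      each nonempty neighbourhood more than half, so they meet.\<close>
    have half: "1 / 2 \<le> threshold (Suc r)" using r by (simp add: th field_simps)
    have W2: "?n / 2 \<le> real (card W)"
      using mult_right_mono[OF half, of ?n] W npos by linarith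
    have big: "card (verts G) < card (nbr G T) + card W" if "nbr G T \<noteq> {}" for T
    proof -
      have "(threshold (Suc r) + \<epsilon>) * ?n \<le> real (card (nbr G T))"
        using deg that by (auto simp: codegree_ge_def)
      moreover have "?n / 2 < (threshold (Suc r) + \<epsilon>) * ?n"
        using mult_strict_right_mono[of "1/2" "threshold (Suc r) + \<epsilon>" ?n] half \<epsilon> npos by simp
      ultimately show ?thesis using W2 by linarith
    qed
    have "codegree_ge ((threshold r + \<epsilon>) * real (card W)) (induced G W)"
      unfolding codegree_ge_def
    proof (intro conjI allI impI)
      show "edges (induced G W) \<noteq> {}"
        using ex_edge_subset[OF G WV _ big] deg by (auto simp: codegree_ge_def induced_def)
      fix T assume "nbr (induced G W) T \<noteq> {}"
      then have T: "nbr (induced G W) T = nbr G T \<inter> W" "nbr G T \<noteq> {}"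
        by (auto simp: nbr_induced split: if_splits)
      have "card (nbr G T) + card W \<le> card (nbr G T \<inter> W) + card (verts G)"
        by (rule card_Int_ge[OF fV nbr_subset[OF G] WV])
      moreover have "(threshold (Suc r) + \<epsilon>) * ?n \<le> real (card (nbr G T))"
        using deg T(2) by (auto simp: codegree_ge_def)
      ultimately have "(threshold (Suc r) + \<epsilon>) * ?n + real (card W) - ?n \<le> real (card (nbr G T \<inter> W))"
        by linarith
      moreover have "\<epsilon> * real (card W) \<le> \<epsilon> * ?n"
        using \<epsilon> \<open>card W \<le> card (verts G)\<close> by simp
      \<comment> \<open>Rescaling the size bound on \<open>W\<close> turns the loss n/(r+1) into the
        fraction 1/r of \<open>W\<close>, the passage from \<open>threshold (Suc r)\<close> to
        \<open>threshold r\<close>.\<close>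
      moreover have "?n / (real r + 1) \<le> real (card W) / real r"
        using W r by (simp add: th field_simps)
      moreover have "threshold (Suc r) * ?n = ?n - ?n / (real r + 1)"
        using r by (simp add: th field_simps)
      moreover have "threshold r * real (card W) = real (card W) - real (card W) / real r"
        using r by (simp add: threshold_def field_simps)
      ultimately show "(threshold r + \<epsilon>) * real (card W) \<le> real (card (nbr (induced G W) T))"
        unfolding T(1) distrib_right by linarith
    qed
    moreover have "n1 \<le> card W" using W2 n unfolding n0_def by linarith
    ultimately show ?thesis
      using n1[OF kgraph_induced[OF G WV]] by (simp add: induced_def W_def)
  qed
  then show ?thesis by (rule that)
qed

text \<open>By induction the neighbourhood of a vertex contains the next smaller complete graph, and
  the vertex is joined to all of it.\<close>

lemma forces_complete_graph:
  assumes "r \<ge> 1"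
  shows "forces 2 (threshold r) (complete_graph (r + 1))"
  using assms
proof (induction r rule: nat_induct_at_least)
  case base
  have "{e :: nat set. e \<subseteq> {..<2} \<and> card e = 2} = {{..<2}}"
    by (auto dest: card_subset_eq[OF finite_lessThan])
  then have "complete_graph (1 + 1) = single_edge 2"
    by (simp add: complete_graph_def single_edge_def numeral_2_eq_2)
  then show ?case using forces_single_edge[of 2] by simp
next
  case (Suc r)
  show ?case unfolding forces_def
  proof (intro allI impI)
    fix \<epsilon> :: real assume "\<epsilon> > 0"
    \<comment> \<open>The case \<open>M\<close> = 0 suffices, as a vertex is never in its own
      neighbourhood.\<close>
    then obtain n0 where n0:
      "\<And>(G :: nat hgraph) S U. kgraph 2 G \<Longrightarrow> n0 \<le> card (verts G) \<Longrightarrow>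
        codegree_ge ((threshold (Suc r) + \<epsilon>) * real (card (verts G))) G \<Longrightarrow>
        nbr G S \<noteq> {} \<Longrightarrow> finite U \<Longrightarrow> card U \<le> 0 \<Longrightarrow>
        contains_copy (induced G (nbr G S - U)) (complete_graph (r + 1))"
      by (rule forces_in_nbr[OF Suc.IH Suc.hyps]) (erule that)
    show "\<exists>n0. \<forall>G :: nat hgraph. kgraph 2 G \<longrightarrow> n0 \<le> card (verts G) \<longrightarrow>
        codegree_ge ((threshold (Suc r) + \<epsilon>) * real (card (verts G))) G \<longrightarrow>
        contains_copy G (complete_graph (Suc r + 1))"
    proof (intro exI[of _ n0] allI impI)
      fix G :: "nat hgraph"
      assume G: "kgraph 2 G" and n: "n0 \<le> card (verts G)"
        and deg: "codegree_ge ((threshold (Suc r) + \<epsilon>) * real (card (verts G))) G"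
      obtain e where e: "e \<in> edges G" using deg by (auto simp: codegree_ge_def)
      then obtain v w where vw: "e = {v, w}" "v \<noteq> w" using G by (auto simp: kgraph_def card_2_iff)
      then have v: "v \<in> verts G" "w \<in> nbr G {v}"
        using e G by (auto simp: kgraph_def nbr_def insert_commute)
      have "nbr G {v} \<noteq> {}" using v(2) by blast
      from n0[OF G n deg this finite.emptyI] obtain f where f: "inj_on f {..<Suc r}" "f ` {..<Suc r} \<subseteq> nbr G {v}"
        and fe: "\<And>e. e \<subseteq> {..<Suc r} \<Longrightarrow> card e = 2 \<Longrightarrow> f ` e \<in> edges G"
        by (auto simp: contains_copy_def induced_def complete_graph_def)
      define h where "h = f(Suc r := v)"
      have vf: "v \<notin> f ` {..<Suc r}" using f(2) by (auto simp: nbr_def)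
      have hf: "h ` A = f ` A" if "A \<subseteq> {..<Suc r}" for A
        using that by (auto simp: h_def intro!: image_cong)
      have "inj_on h {..<Suc (Suc r)}"
        using f(1) vf unfolding lessThan_Suc[of "Suc r"]
        by (auto simp: h_def inj_on_def)
      moreover have "h ` {..<Suc (Suc r)} \<subseteq> verts G"
        unfolding lessThan_Suc[of "Suc r"] using hf[of "{..<Suc r}"] f(2) nbr_subset[OF G] v(1)
        by (auto simp: h_def)
      moreover have "h ` e \<in> edges G" if e: "e \<subseteq> {..<Suc (Suc r)}" "card e = 2" for e
      proof (cases "Suc r \<in> e")
        case False
        then have "e \<subseteq> {..<Suc r}" using e(1) by (auto simp: less_Suc_eq)
        then show ?thesis using fe hf e(2) by simp
      next
        case True
        then obtain x where x: "e = {x, Suc r}" "x \<noteq> Suc r"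
          using e(2) by (auto simp: card_2_iff doubleton_eq_iff)
        then have "x < Suc r" using e(1) by auto
        then have "f x \<in> nbr G {v}" using f(2) by auto
        then show ?thesis using x by (auto simp: h_def nbr_def)
      qed
      ultimately show "contains_copy G (complete_graph (Suc r + 1))" unfolding contains_copy_def
        by (intro exI[of _ h]) (simp add: complete_graph_def)
    qed
  qed
qed

section \<open>Assembling copies of F(R,H)\<close>

text \<open>Glues an embedding of the core to embeddings of the attached copies. Avoiding the core
  and pairwise disjointness make the combined map injective.\<close>

lemma contains_copy_F_constr:
  fixes G :: "'a hgraph"
  assumes R: "\<And>S. S \<in> edges R \<Longrightarrow> finite S \<and> S \<subseteq> verts R" and H: "\<And>e. e \<in> edges H \<Longrightarrow> e \<subseteq> verts H"
    and f: "inj_on f (verts R)" "f ` verts R \<subseteq> verts G"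
    and g: "\<And>S. S \<in> edges R \<Longrightarrow> inj_on (g S) (verts H)"
      "\<And>S. S \<in> edges R \<Longrightarrow> g S ` verts H \<subseteq> verts G - f ` verts R"
      "\<And>S x. S \<in> edges R \<Longrightarrow> x \<in> verts H \<Longrightarrow> insert (g S x) (f ` S) \<in> edges G"
      "\<And>S e. S \<in> edges R \<Longrightarrow> e \<in> edges H \<Longrightarrow> g S ` e \<in> edges G"
      "\<And>S T. S \<in> edges R \<Longrightarrow> T \<in> edges R \<Longrightarrow> S \<noteq> T \<Longrightarrow> g S ` verts H \<inter> g T ` verts H = {}"
  shows "contains_copy G (F_constr R H)"
proof -
  \<comment> \<open>The vertex encoding is inverted; \<open>set_decode\<close> recovers
    \<open>S\<close> because core edges are finite.\<close>
  define h where "h y = (case sum_decode y of Inl x \<Rightarrow> f x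
    | Inr p \<Rightarrow> (case prod_decode p of (s, x) \<Rightarrow> g (set_decode s) x))" for y
  have hc: "h (core_vertex x) = f x" for x by (simp add: h_def core_vertex_def)
  have hg: "h (copy_vertex S x) = g S x" if "S \<in> edges R" for S x
    using R[OF that] by (simp add: h_def copy_vertex_def)
  have imc: "h ` core_vertex ` A = f ` A" for A by (simp add: image_image hc)
  have img: "h ` copy_vertex S ` A = g S ` A" if "S \<in> edges R" for S A
    using that by (simp add: image_image hg)
  have "inj_on h (verts (F_constr R H))"
  proof (rule inj_onI)
    fix y z assume y: "y \<in> verts (F_constr R H)" and z: "z \<in> verts (F_constr R H)" and eq: "h y = h z"
    have "(\<exists>x\<in>verts R. y = core_vertex x) \<or> (\<exists>S\<in>edges R. \<exists>x\<in>verts H. y = copy_vertex S x)"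
      and "(\<exists>x\<in>verts R. z = core_vertex x) \<or> (\<exists>S\<in>edges R. \<exists>x\<in>verts H. z = copy_vertex S x)"
      using y z by (auto simp: F_constr_def)
    then show "y = z"
    proof (elim disjE bexE)
      fix x x' assume "x \<in> verts R" "x' \<in> verts R" "y = core_vertex x" "z = core_vertex x'"
      then show ?thesis using eq f(1) by (auto simp: hc inj_on_def)
    next
      fix x S x' assume "x \<in> verts R" "S \<in> edges R" "x' \<in> verts H"
        "y = core_vertex x" "z = copy_vertex S x'"
      then show ?thesis using eq g(2)[of S] by (auto simp: hc hg)
    next
      fix x S x' assume "x \<in> verts R" "S \<in> edges R" "x' \<in> verts H"
        "z = core_vertex x" "y = copy_vertex S x'"
      then show ?thesis using eq g(2)[of S] by (auto simp: hc hg)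
    next
      fix S T x x' assume *: "S \<in> edges R" "T \<in> edges R" "x \<in> verts H" "x' \<in> verts H"
        "y = copy_vertex S x" "z = copy_vertex T x'"
      then have "g S x = g T x'" using eq by (simp add: hg)
      moreover from this have "S = T" using g(5)[of S T] * by blast
      ultimately show ?thesis using g(1)[of S] * by (auto simp: inj_on_def)
    qed
  qed
  moreover have "h ` verts (F_constr R H) \<subseteq> verts G"
    using f(2) g(2) by (auto simp: F_constr_def hc hg subset_iff)
  moreover have "h ` e \<in> edges G" if "e \<in> edges (F_constr R H)" for e
    using that unfolding F_constr_def
    by (auto simp: img g(4) imc hg g(3))
  ultimately show ?thesis unfolding contains_copy_def by blast
qed

text \<open>Greedy choice: images chosen earlier occupy at most \<open>card E * card A\<close>
  points, so together they may serve as the forbidden set \<open>U\<close> for the next one.\<close>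

lemma ex_disjoint_family:
  assumes "finite E" "finite A"
    and "\<And>S U. S \<in> E \<Longrightarrow> finite U \<Longrightarrow> card U \<le> card E * card A \<Longrightarrow> \<exists>h. P S h \<and> h ` A \<inter> U = {}"
  shows "\<exists>g. (\<forall>S\<in>E. P S (g S)) \<and> (\<forall>S\<in>E. \<forall>T\<in>E. S \<noteq> T \<longrightarrow> g S ` A \<inter> g T ` A = {})"
  using assms(1,3)
proof (induction E rule: finite_induct)
  case (insert S E)
  have "\<exists>h. P T h \<and> h ` A \<inter> U = {}" if "T \<in> E" "finite U" "card U \<le> card E * card A" for T U
    using insert.prems[of T U] that insert.hyps by simp
  from insert.IH[OF this] obtain g where g: "\<forall>T\<in>E. P T (g T)"
    "\<forall>T\<in>E. \<forall>T'\<in>E. T \<noteq> T' \<longrightarrow> g T ` A \<inter> g T' ` A = {}" by auto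
  define U where "U = (\<Union>T\<in>E. g T ` A)"
  have "card U \<le> (\<Sum>T\<in>E. card (g T ` A))"
    unfolding U_def using insert.hyps by (intro card_UN_le)
  also have "\<dots> \<le> card E * card A"
    using sum_bounded_above[of E "\<lambda>T. card (g T ` A)" "card A"] by (simp add: card_image_le assms(2))
  finally have "card U \<le> card (insert S E) * card A" using insert.hyps by simp
  moreover have "finite U" using insert.hyps assms(2) by (simp add: U_def)
  ultimately obtain h where h: "P S h" "h ` A \<inter> U = {}" using insert.prems[of S U] by auto
  have new: "h ` A \<inter> g T ` A = {}" if "T \<in> E" for T using h(2) that unfolding U_def by blast
  have gT: "(g(S := h)) T = g T" if "T \<in> E" for T using that insert.hyps by auto
  show ?case
    using g h(1) new gT insert.hyps(2) by (intro exI[of _ "g(S := h)"]) (simp add: Int_commute)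
qed simp

text \<open>The core is found in the link of a vertex \<open>v\<close> of some edge, so
  \<open>v\<close> is a common neighbour of all core edges. Their neighbourhoods are therefore
  nonempty, hence large, and each yields a copy of \<open>H\<close> off the core and the earlier
  copies.\<close>

lemma forces_F_constr:
  assumes R: "kgraph (k - 1) R" and H: "kgraph k H" and k: "k \<ge> 1" and r: "r \<ge> 1"
    and fR: "forces (k - 1) (threshold (Suc r)) R" and fH: "forces k (threshold r) H"
  shows "forces k (threshold (Suc r)) (F_constr R H)"
  unfolding forces_def
proof (intro allI impI)
  fix \<epsilon> :: real assume \<epsilon>: "\<epsilon> > 0"
  obtain n1 where n1: "\<And>G :: nat hgraph. kgraph (k - 1) G \<Longrightarrow> n1 \<le> card (verts G) \<Longrightarrow>
      codegree_ge ((threshold (Suc r) + \<epsilon>) * real (card (verts G))) G \<Longrightarrow> contains_copy G R"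
    by (rule forcesE[OF fR \<epsilon>]) (erule that)
  \<comment> \<open>Bounds what a new copy may have to avoid: the core and all other copies.\<close>
  define M where "M = card (verts R) + card (edges R) * card (verts H)"
  obtain n2 where n2: "\<And>(G :: nat hgraph) S U. kgraph k G \<Longrightarrow> n2 \<le> card (verts G) \<Longrightarrow>
      codegree_ge ((threshold (Suc r) + \<epsilon>) * real (card (verts G))) G \<Longrightarrow>
      nbr G S \<noteq> {} \<Longrightarrow> finite U \<Longrightarrow> card U \<le> M \<Longrightarrow> contains_copy (induced G (nbr G S - U)) H"
    by (rule forces_in_nbr[OF fH r \<epsilon>]) (erule that)
  have finR: "finite (verts R)" "finite (edges R)" and finH: "finite (verts H)"
    using R H kgraph_finite_edges[OF R] by (auto simp: kgraph_def)
  show "\<exists>n0. \<forall>G :: nat hgraph. kgraph k G \<longrightarrow> n0 \<le> card (verts G) \<longrightarrow>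
      codegree_ge ((threshold (Suc r) + \<epsilon>) * real (card (verts G))) G \<longrightarrow>
      contains_copy G (F_constr R H)"
  proof (intro exI[of _ "max n1 n2"] allI impI)
    fix G :: "nat hgraph"
    assume G: "kgraph k G" and n: "max n1 n2 \<le> card (verts G)"
      and deg: "codegree_ge ((threshold (Suc r) + \<epsilon>) * real (card (verts G))) G"
    obtain e where e: "e \<in> edges G" using deg by (auto simp: codegree_ge_def)
    then have "e \<noteq> {}" using G k by (auto simp: kgraph_def)
    then obtain v where v: "v \<in> e" by auto
    then have "e - {v} \<in> edges (link G v)" using e by (simp add: link_def insert_absorb)
    \<comment> \<open>The link keeps all vertices of \<open>G\<close>, and its nonempty
      neighbourhoods are neighbourhoods in \<open>G\<close>, so the bound transfers
      verbatim.\<close>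
    then have "codegree_ge ((threshold (Suc r) + \<epsilon>) * real (card (verts G))) (link G v)"
      using deg by (auto simp: codegree_ge_def nbr_link)
    then have "contains_copy (link G v) R"
      using n n1[OF kgraph_link[OF G]] by (simp add: link_def)
    then obtain f where f: "inj_on f (verts R)" "f ` verts R \<subseteq> verts G"
      and fe: "\<And>S. S \<in> edges R \<Longrightarrow> v \<in> nbr G (f ` S)"
      by (auto simp: contains_copy_def link_def nbr_def)
    define P where "P S h \<longleftrightarrow> inj_on h (verts H) \<and> h ` verts H \<subseteq> nbr G (f ` S) - f ` verts R \<and>
      (\<forall>e\<in>edges H. h ` e \<in> edges G)" for S h
    have avoid: "\<exists>h. P S h \<and> h ` verts H \<inter> U = {}"
      if S: "S \<in> edges R" and U: "finite U" "card U \<le> card (edges R) * card (verts H)" for S U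
    proof -
      have "card (f ` verts R \<union> U) \<le> card (f ` verts R) + card U" by (rule card_Un_le)
      then have "card (f ` verts R \<union> U) \<le> M"
        using card_image_le[OF finR(1), of f] U(2) unfolding M_def by linarith
      moreover have "nbr G (f ` S) \<noteq> {}" using fe[OF S] by blast
      moreover have "n2 \<le> card (verts G)" using n by simp
      ultimately have "contains_copy (induced G (nbr G (f ` S) - (f ` verts R \<union> U))) H"
        using n2[OF G _ deg] finR(1) U(1) by simp
      then obtain h where "inj_on h (verts H)" "h ` verts H \<subseteq> nbr G (f ` S) - (f ` verts R \<union> U)"
        "\<forall>e\<in>edges H. h ` e \<in> edges G"
        unfolding contains_copy_def induced_def by auto
      then show ?thesis unfolding P_def by (intro exI[of _ h]) blast
    qed
    have "\<exists>g. (\<forall>S\<in>edges R. P S (g S)) \<and>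
      (\<forall>S\<in>edges R. \<forall>T\<in>edges R. S \<noteq> T \<longrightarrow> g S ` verts H \<inter> g T ` verts H = {})"
      using finR(2) finH avoid by (rule ex_disjoint_family)
    then obtain g where
      gP: "\<forall>S\<in>edges R. P S (g S)" and
      gd: "\<forall>S\<in>edges R. \<forall>T\<in>edges R. S \<noteq> T \<longrightarrow> g S ` verts H \<inter> g T ` verts H = {}"
      by (elim exE conjE)
    have g: "inj_on (g S) (verts H)" "g S ` verts H \<subseteq> nbr G (f ` S) - f ` verts R"
      "\<forall>e\<in>edges H. g S ` e \<in> edges G" if "S \<in> edges R" for S
      using bspec[OF gP that] unfolding P_def by auto
    show "contains_copy G (F_constr R H)"
    proof (rule contains_copy_F_constr[where f = f and g = g])
      show "finite S \<and> S \<subseteq> verts R" if "S \<in> edges R" for S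
        using that R kgraph_finite_edge[OF R] by (auto simp: kgraph_def)
      show "e \<subseteq> verts H" if "e \<in> edges H" for e using that H by (auto simp: kgraph_def)
      show "g S ` verts H \<subseteq> verts G - f ` verts R" if "S \<in> edges R" for S
        using g(2)[OF that] nbr_subset[OF G] by blast
      show "insert (g S x) (f ` S) \<in> edges G" if "S \<in> edges R" "x \<in> verts H" for S x
        using g(2)[OF that(1)] that(2) by (auto simp: nbr_def)
    qed (use f g(1) g(3) gd in simp_all)
  qed
qed

text \<open>The recursion matches the thresholds: the core keeps r at smaller uniformity and the
  attached graph has r - 1, as in \<open>forces_F_constr\<close>.\<close>

lemma forces_H_graph: "r \<ge> 1 \<Longrightarrow> k \<ge> 2 \<Longrightarrow> forces k (threshold r) (H_graph r k)"
proof (induction r k rule: H_graph.induct)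
  case (1 r k)
  consider "r = 1" | "r > 1" "k = 2" | "r > 1" "k > 2" using 1(3,4) by linarith
  then show ?case
  proof cases
    case 1
    then show ?thesis using forces_single_edge[of k] \<open>k \<ge> 2\<close> by (simp add: H_graph.simps)
  next
    case 2
    then show ?thesis using forces_complete_graph[of r] by (simp add: H_graph.simps)
  next
    case 3
    then have *: "\<not> r \<le> 1" "\<not> k \<le> 2" "1 \<le> r - 1" "2 \<le> k - 1" "1 \<le> k" "Suc (r - 1) = r" by auto
    have "forces (k - 1) (threshold (Suc (r - 1))) (H_graph r (k - 1))"
      using "1.IH"(1)[OF *(1,2) \<open>r \<ge> 1\<close> *(4)] *(6) by simp
    moreover have "forces k (threshold (r - 1)) (H_graph (r - 1) k)"
      by (rule "1.IH"(2)[OF *(1,2,3) \<open>k \<ge> 2\<close>])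
    ultimately have "forces k (threshold (Suc (r - 1))) (F_constr (H_graph r (k - 1)) (H_graph (r - 1) k))"
      by (rule forces_F_constr[OF kgraph_H_graph[OF \<open>r \<ge> 1\<close> *(4)] kgraph_H_graph[OF *(3) \<open>k \<ge> 2\<close>] *(5,3)])
    then show ?thesis using 3 *(6) by (subst H_graph.simps) simp
  qed
qed

section \<open>Colourings\<close>

lemma colourableI:
  assumes "c ` verts H \<subseteq> {..<r}" "\<And>e i. e \<in> edges H \<Longrightarrow> \<exists>v\<in>e. c v \<noteq> i"
  shows "colourable r H"
  unfolding colourable_def using assms by (intro exI[of _ c]) simp

lemma colourableE:
  assumes "colourable r H"
  obtains c where "c ` verts H \<subseteq> {..<r}" "\<And>e i. e \<in> edges H \<Longrightarrow> \<exists>v\<in>e. c v \<noteq> i"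
proof -
  obtain c where c: "c ` verts H \<subseteq> {..<r}" "\<forall>e\<in>edges H. \<not> (\<exists>i. \<forall>v\<in>e. c v = i)"
    using assms unfolding colourable_def by (elim exE conjE)
  show ?thesis
  proof (rule that[OF c(1)])
    show "\<exists>v\<in>e. c v \<noteq> i" if "e \<in> edges H" for e i
      using bspec[OF c(2) that] by metis
  qed
qed

text \<open>Some core edge \<open>S\<close> has a single colour i. Each edge formed from
  \<open>S\<close> and a vertex of the attached copy forbids i there, so that copy uses only r - 1
  colours.\<close>

lemma colourable_F_constrD:
  assumes R: "kgraph j R" "j \<ge> 1" and H: "kgraph k H" and col: "colourable r (F_constr R H)"
    and not: "\<not> colourable r R"
  shows "colourable (r - 1) H"
proof -
  obtain c where c: "c ` verts (F_constr R H) \<subseteq> {..<r}"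
    "\<And>e i. e \<in> edges (F_constr R H) \<Longrightarrow> \<exists>v\<in>e. c v \<noteq> i"
    by (rule colourableE[OF col]) (erule that)
  have im: "(c \<circ> core_vertex) ` verts R \<subseteq> {..<r}" using c(1) by (auto simp: F_constr_def)
  have "\<exists>S\<in>edges R. \<exists>i. \<forall>v\<in>S. c (core_vertex v) = i"
  proof (rule ccontr)
    assume "\<not> ?thesis"
    then have "colourable r R" by (intro colourableI[OF im]) simp
    with not show False by contradiction
  qed
  then obtain S i where S: "S \<in> edges R" "\<And>v. v \<in> S \<Longrightarrow> c (core_vertex v) = i" by blast
  \<comment> \<open>Positive uniformity makes \<open>S\<close> nonempty, so i is a genuine colour
    below r.\<close>
  have "S \<noteq> {}" "S \<subseteq> verts R" using S(1) R by (auto simp: kgraph_def)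
  then obtain v where "v \<in> S" "v \<in> verts R" by auto
  then have i: "i < r" using S(2)[of v] subsetD[OF im, of i] by force
  have ne: "c (copy_vertex S x) \<noteq> i" if "x \<in> verts H" for x
  proof -
    have "insert (copy_vertex S x) (core_vertex ` S) \<in> edges (F_constr R H)"
      using S(1) that by (auto simp: F_constr_def)
    from c(2)[OF this, of i] show ?thesis using S(2) by auto
  qed
  \<comment> \<open>Relabelling closes the gap at i: larger colours move down by one.\<close>
  define d where "d x = (let y = c (copy_vertex S x) in if y < i then y else y - 1)" for x
  have lt: "c (copy_vertex S x) < r" if "x \<in> verts H" for x
    using subsetD[OF c(1), of "c (copy_vertex S x)"] that S(1) by (auto simp: F_constr_def)
  have "d ` verts H \<subseteq> {..<r - 1}"
  proof (rule image_subsetI)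
    fix x assume "x \<in> verts H"
    from lt[OF this] ne[OF this] i show "d x \<in> {..<r - 1}" by (auto simp: d_def Let_def)
  qed
  then show ?thesis
  proof (rule colourableI)
    fix e a assume e: "e \<in> edges H"
    have "copy_vertex S ` e \<in> edges (F_constr R H)"
      unfolding F_constr_def snd_conv using S(1) e by blast
    \<comment> \<open>The instance is the colour other than i that the relabelling sends to
      \<open>a\<close>.\<close>
    from c(2)[OF this, of "if a < i then a else Suc a"]
    obtain v where v: "v \<in> e" "c (copy_vertex S v) \<noteq> (if a < i then a else Suc a)" by auto
    have "v \<in> verts H" using v(1) e H by (auto simp: kgraph_def)
    then have "d v \<noteq> a" using ne[of v] v(2) by (auto simp: d_def Let_def split: if_splits)
    then show "\<exists>v\<in>e. d v \<noteq> a" using v(1) by blast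
  qed
qed

lemma not_colourable_complete_graph: "\<not> colourable r (complete_graph (r + 1))"
proof
  assume "colourable r (complete_graph (r + 1))"
  then obtain c where c: "c ` {..<Suc r} \<subseteq> {..<r}"
    "\<And>e i. e \<subseteq> {..<Suc r} \<Longrightarrow> card e = 2 \<Longrightarrow> \<exists>v\<in>e. c v \<noteq> i"
    by (auto simp: colourable_def complete_graph_def)
  have "inj_on c {..<Suc r}"
  proof (rule inj_onI, rule ccontr)
    fix x y assume "x \<in> {..<Suc r}" "y \<in> {..<Suc r}" "c x = c y" "x \<noteq> y"
    then show False using c(2)[of "{x, y}" "c y"] by auto
  qed
  then have "card {..<Suc r} \<le> card {..<r}" using c(1) by (intro card_inj_on_le) auto
  then show False by simp
qed

lemma not_colourable_H_graph: "r \<ge> 1 \<Longrightarrow> k \<ge> 2 \<Longrightarrow> \<not> colourable r (H_graph r k)"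
proof (induction r k rule: H_graph.induct)
  case (1 r k)
  consider "r = 1" | "r > 1" "k = 2" | "r > 1" "k > 2" using 1(3,4) by linarith
  then show ?case
  proof cases
    case 1
    have "\<not> colourable 1 (single_edge k)"
      by (auto simp: colourable_def single_edge_def)
    then show ?thesis using 1 by (simp add: H_graph.simps)
  next
    case 2
    then show ?thesis using not_colourable_complete_graph[of r] by (simp add: H_graph.simps)
  next
    case 3
    then have *: "\<not> r \<le> 1" "\<not> k \<le> 2" "1 \<le> r - 1" "2 \<le> k - 1" "1 \<le> k - 1" by auto
    have "\<not> colourable r (F_constr (H_graph r (k - 1)) (H_graph (r - 1) k))"
    proof
      assume "colourable r (F_constr (H_graph r (k - 1)) (H_graph (r - 1) k))"
      then have "colourable (r - 1) (H_graph (r - 1) k)"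
        using "1.IH"(1)[OF *(1,2) \<open>r \<ge> 1\<close> *(4)]
        by (rule colourable_F_constrD[OF kgraph_H_graph[OF \<open>r \<ge> 1\<close> *(4)] *(5) kgraph_H_graph[OF *(3) \<open>k \<ge> 2\<close>]])
      then show False using "1.IH"(2)[OF *(1,2,3) \<open>k \<ge> 2\<close>] by contradiction
    qed
    then show ?thesis using 3 by (subst H_graph.simps) simp
  qed
qed

text \<open>Composing with the embedding pulls the colouring back. In contrapositive form this makes
  r-colourable hosts free of a non-r-colourable \<open>F\<close>.\<close>

lemma colourable_contains_copy:
  assumes "colourable r H" "contains_copy H F"
  shows "colourable r F"
proof -
  obtain c where c: "c ` verts H \<subseteq> {..<r}" "\<And>e i. e \<in> edges H \<Longrightarrow> \<exists>v\<in>e. c v \<noteq> i"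
    by (rule colourableE[OF assms(1)]) (erule that)
  obtain f where f: "f ` verts F \<subseteq> verts H" "\<And>e. e \<in> edges F \<Longrightarrow> f ` e \<in> edges H"
    using assms(2) unfolding contains_copy_def by blast
  show ?thesis
  proof (rule colourableI)
    show "(c \<circ> f) ` verts F \<subseteq> {..<r}" using c(1) f(1) by auto
    show "\<exists>v\<in>e. (c \<circ> f) v \<noteq> i" if "e \<in> edges F" for e i
      using c(2)[OF f(2)[OF that], of i] by simp
  qed
qed

section \<open>The lower bound\<close>

text \<open>The extremal example for the lower bound. Residues mod r give an explicit partition into
  classes of nearly equal size.\<close>

definition mod_graph :: "nat \<Rightarrow> nat \<Rightarrow> nat \<Rightarrow> nat hgraph" where
  "mod_graph r k n = ({..<n}, {e. e \<subseteq> {..<n} \<and> card e = k \<and> \<not> (\<exists>i. \<forall>v\<in>e. v mod r = i)})"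

lemma kgraph_mod_graph: "kgraph k (mod_graph r k n)"
  by (auto simp: kgraph_def mod_graph_def)

lemma colourable_mod_graph: "r \<ge> 1 \<Longrightarrow> colourable r (mod_graph r k n)"
  unfolding colourable_def mod_graph_def by (intro exI[of _ "\<lambda>v. v mod r"]) auto

text \<open>Within a residue class the quotient determines the element. The crude additive constant
  vanishes in the limit.\<close>

lemma card_residue_class_le: "card {x. x < n \<and> x mod r = i} \<le> Suc (n div r)" for r :: nat
proof -
  have "inj_on (\<lambda>x. x div r) {x. x < n \<and> x mod r = i}"
    by (rule inj_onI) (metis (mono_tags, lifting) div_mult_mod_eq mem_Collect_eq)
  moreover have "(\<lambda>x. x div r) ` {x. x < n \<and> x mod r = i} \<subseteq> {..n div r}"
    by (auto simp: div_le_mono)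
  ultimately have "card {x. x < n \<and> x mod r = i} \<le> card {..n div r}"
    by (intro card_inj_on_le) auto
  then show ?thesis by simp
qed

text \<open>If \<open>S\<close> has positive codegree and s lies in \<open>S\<close>, every vertex
  outside \<open>S\<close> with residue other than that of s completes an edge. This excludes only
  the k - 1 vertices of \<open>S\<close> and one residue class.\<close>

lemma min_pos_codegree_mod_graph:
  assumes r: "r \<ge> 1" and k: "k \<ge> 2"
  shows "n - n div r - k \<le> min_pos_codegree k (mod_graph r k n)"
proof (cases "edges (mod_graph r k n) = {}")
  case True
  \<comment> \<open>The codegree is 0 by convention here, and either case makes the truncated
    difference 0. Otherwise \<open>{..<k}\<close> would be an edge, as it contains 0 and 1, whose
    residues differ for r \<ge> 2.\<close>
  have "r = 1 \<or> n < k"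
  proof (rule ccontr)
    assume "\<not> (r = 1 \<or> n < k)"
    then have *: "r \<ge> 2" "k \<le> n" using r by auto
    have "\<not> (\<exists>i. \<forall>v\<in>{..<k}. v mod r = i)"
    proof
      assume "\<exists>i. \<forall>v\<in>{..<k}. v mod r = i"
      then obtain i where "\<And>v. v < k \<Longrightarrow> v mod r = i" by auto
      from this[of 0] this[of 1] have "0 mod r = 1 mod r" using k by simp
      then show False using * by simp
    qed
    then have "{..<k} \<in> edges (mod_graph r k n)" using * by (auto simp: mod_graph_def)
    with True show False by simp
  qed
  then show ?thesis by auto
next
  case False
  have "n - n div r - k \<le> card (nbr (mod_graph r k n) S)" if "nbr (mod_graph r k n) S \<noteq> {}" for S
  proof -
    obtain x where x: "x \<notin> S" "insert x S \<in> edges (mod_graph r k n)"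
      using \<open>nbr (mod_graph r k n) S \<noteq> {}\<close> by (auto simp: nbr_def)
    then have S: "S \<subseteq> {..<n}" "card (insert x S) = k" by (auto simp: mod_graph_def)
    have fS: "finite S" using S(1) finite_subset by blast
    have cS: "Suc (card S) = k" using S fS x(1) by simp
    then obtain s where s: "s \<in> S" using k by fastforce
    let ?C = "{x. x < n \<and> x mod r = s mod r}"
    have "{..<n} - (S \<union> ?C) \<subseteq> nbr (mod_graph r k n) S"
    proof
      fix y assume y: "y \<in> {..<n} - (S \<union> ?C)"
      then have "y mod r \<noteq> s mod r" by auto
      then have "\<not> (\<exists>i. \<forall>v\<in>insert y S. v mod r = i)" using s by (metis insert_iff)
      then show "y \<in> nbr (mod_graph r k n) S"
        using y S(1) cS fS unfolding nbr_def mod_graph_def by (simp del: insert_iff ball_simps)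
    qed
    then have "card ({..<n} - (S \<union> ?C)) \<le> card (nbr (mod_graph r k n) S)"
      by (rule card_mono[OF finite_nbr[OF kgraph_mod_graph]])
    moreover have "card {..<n} - card (S \<union> ?C) \<le> card ({..<n} - (S \<union> ?C))"
      using fS by (intro diff_card_le_card_Diff) auto
    moreover have "card (S \<union> ?C) \<le> card S + card ?C" by (rule card_Un_le)
    moreover have "card ?C \<le> Suc (n div r)" by (rule card_residue_class_le)
    \<comment> \<open>The \<open>Suc\<close> of the class bound joins \<open>card S\<close> = k - 1
      to give the k subtracted.\<close>
    ultimately show ?thesis using cS by simp
  qed
  then show ?thesis
    using min_pos_codegree_ge_iff[OF kgraph_mod_graph _ False] k by simp
qed

text \<open>Being r-colourable, \<open>mod_graph\<close> is \<open>F\<close>-free and competes in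
  the maximum; finiteness from \<open>ex_plus_wf\<close> makes \<open>Max\<close> an upper
  bound.\<close>

lemma ex_plus_ge:
  fixes F :: "'a hgraph"
  assumes r: "r \<ge> 1" and k: "k \<ge> 2" and F: "edges F \<noteq> {}" "\<not> colourable r F"
  shows "n - n div r - k \<le> ex_plus k n F"
proof -
  have "\<not> contains_copy (mod_graph r k n) F"
    using colourable_contains_copy[OF colourable_mod_graph[OF r]] F(2) by blast
  moreover have "card (verts (mod_graph r k n)) = n" by (simp add: mod_graph_def)
  ultimately have "min_pos_codegree k (mod_graph r k n) \<in> {min_pos_codegree k H | H :: nat hgraph.
      kgraph k H \<and> card (verts H) = n \<and> \<not> contains_copy H F}"
    using kgraph_mod_graph by blast
  then have "min_pos_codegree k (mod_graph r k n) \<le> ex_plus k n F"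
    unfolding ex_plus_def using ex_plus_wf(1)[of k F n] F(1) k by (intro Max_ge) auto
  then show ?thesis using min_pos_codegree_mod_graph[OF r k, of n] by linarith
qed

section \<open>The upper bound and the limit\<close>

text \<open>A maximiser beyond the bound would be a host to which \<open>forces\<close> applies, yet
  it is \<open>F\<close>-free.\<close>

lemma ex_plus_le:
  fixes F :: "'a hgraph"
  assumes F: "forces k \<alpha> F" "edges F \<noteq> {}" and k: "k \<ge> 1" and \<alpha>: "\<alpha> \<ge> 0" and \<epsilon>: "\<epsilon> > 0"
  shows "\<exists>n0. \<forall>n\<ge>n0. real (ex_plus k n F) \<le> (\<alpha> + \<epsilon>) * real n"
proof -
  obtain n0 where n0: "\<And>G :: nat hgraph. kgraph k G \<Longrightarrow> n0 \<le> card (verts G) \<Longrightarrow>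
      codegree_ge ((\<alpha> + \<epsilon>) * real (card (verts G))) G \<Longrightarrow> contains_copy G F"
    by (rule forcesE[OF F(1) \<epsilon>]) (erule that)
  have "real (ex_plus k n F) \<le> (\<alpha> + \<epsilon>) * real n" if n: "n \<ge> n0" for n
  proof (rule ccontr)
    assume "\<not> ?thesis"
    then have less: "(\<alpha> + \<epsilon>) * real n < real (ex_plus k n F)" by simp
    obtain G :: "nat hgraph" where G: "ex_plus k n F = min_pos_codegree k G" "kgraph k G"
      "card (verts G) = n" "\<not> contains_copy G F"
      using Max_in[OF ex_plus_wf[OF k F(2), of n]] unfolding ex_plus_def by auto
    \<comment> \<open>Nonnegativity rules out the default value 0, so the maximiser has an
      edge.\<close>
    have "0 \<le> (\<alpha> + \<epsilon>) * real n" using \<alpha> \<epsilon> by simp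
    then have "min_pos_codegree k G > 0" using less G(1) by linarith
    then have ne: "edges G \<noteq> {}" by (auto simp: min_pos_codegree_def)
    have "(\<alpha> + \<epsilon>) * real n \<le> real (card (nbr G S))" if "nbr G S \<noteq> {}" for S
    proof -
      have "ex_plus k n F \<le> card (nbr G S)"
        using min_pos_codegree_ge_iff[OF G(2) k ne, of "ex_plus k n F"] that G(1) by simp
      then show ?thesis using less by linarith
    qed
    then have "codegree_ge ((\<alpha> + \<epsilon>) * real n) G" using ne by (simp add: codegree_ge_def)
    then show False using n0[OF G(2)] G(3,4) n by simp
  qed
  then show ?thesis by blast
qed

text \<open>Convergence is included because \<open>gamma_plus\<close> is a \<open>lim\<close>, whose
  value says nothing for a divergent sequence.\<close>

theorem corollary4:
  fixes r k :: nat
  assumes "r \<ge> 1" and "k \<ge> 2"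
  shows "convergent (\<lambda>n. real (ex_plus k n (H_graph r k)) / real n)
       \<and> gamma_plus k (H_graph r k) = (real r - 1) / real r
       \<and> \<not> colourable r (H_graph r k)"
proof -
  let ?F = "H_graph r k"
  let ?q = "\<lambda>n. real (ex_plus k n ?F) / real n"
  have ncol: "\<not> colourable r ?F" using not_colourable_H_graph assms by blast
  \<comment> \<open>An edgeless graph can be coloured constantly. Having an edge makes the
    \<open>Max\<close> in \<open>ex_plus\<close> meaningful.\<close>
  have ne: "edges ?F \<noteq> {}"
  proof
    assume "edges ?F = {}"
    then have "colourable r ?F"
      unfolding colourable_def using assms(1) by (intro exI[of _ "\<lambda>_. 0"]) auto
    with ncol show False by simp
  qed
  have "?q \<longlonglongrightarrow> threshold r"
  proof (rule LIMSEQ_I)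
    fix \<epsilon> :: real assume \<epsilon>: "\<epsilon> > 0"
    have th: "threshold r \<ge> 0" using assms(1) by (simp add: threshold_def)
    obtain n1 where n1: "\<And>n. n \<ge> n1 \<Longrightarrow> real (ex_plus k n ?F) \<le> (threshold r + \<epsilon> / 2) * real n"
      using ex_plus_le[OF forces_H_graph[OF assms] ne _ th, of "\<epsilon> / 2"] assms(2) \<epsilon> by auto
    \<comment> \<open>Half of \<epsilon> pays for the additive loss k once n is at least 2 k /
      \<epsilon>; \<open>Suc\<close> permits division by n.\<close>
    define n0 where "n0 = Suc (max n1 (nat \<lceil>2 * real k / \<epsilon>\<rceil>))"
    have "norm (?q n - threshold r) < \<epsilon>" if n: "n \<ge> n0" for n
    proof -
      have npos: "real n > 0" using n by (simp add: n0_def)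
      have "2 * real k / \<epsilon> \<le> real n" using n unfolding n0_def by linarith
      then have "real k \<le> \<epsilon> / 2 * real n" using \<epsilon> by (simp add: field_simps)
      moreover have "real n - real (n div r) - real k \<le> real (ex_plus k n ?F)"
        using ex_plus_ge[OF assms ne ncol, of n] by linarith
      moreover have "real (n div r) \<le> real n / real r" by (rule of_nat_div_le_of_nat)
      moreover have "threshold r * real n = real n - real n / real r"
        using assms(1) by (simp add: threshold_def field_simps)
      ultimately have "(threshold r - \<epsilon> / 2) * real n \<le> real (ex_plus k n ?F)"
        unfolding left_diff_distrib by linarith
      then have "threshold r - \<epsilon> / 2 \<le> ?q n" using npos by (simp add: field_simps)
      moreover have "?q n \<le> threshold r + \<epsilon> / 2"
        using n1[of n] n npos by (simp add: n0_def field_simps)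
      ultimately have "\<bar>?q n - threshold r\<bar> \<le> \<epsilon> / 2" by linarith
      then show ?thesis using \<epsilon> by simp
    qed
    then show "\<exists>n0. \<forall>n\<ge>n0. norm (?q n - threshold r) < \<epsilon>" by blast
  qed
  then show ?thesis
    using ncol limI[of ?q] by (auto simp: gamma_plus_def threshold_def convergent_def)
qed

end
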